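(* Consider the following four restrictions on hedonic diversity games and IS dynamics: (1) all agents' preferences are naturally single-peaked; (2) all agents' preferences are strict; (3) the initial partition is the singleton partition; (4) every deviation performed satisfies solitary homogeneity. For every choice of three of these four restrictions, there exist a hedonic diversity game and an initial partition satisfying these three restrictions together with an infinite sequence of IS deviations starting from that initial partition (all satisfying the chosen restrictions), i.e., the IS dynamics may cycle.
   Context: A hedonic diversity game (HDG) has agent set $N=R\cup B$ partitioned into red agents $R$ and blue agents $B$, $|N|=n$. Each agent $i$ has a weak order $\succsim_i^F$ over the set of fractions $\{p/q: p\in\{0,\dots,|R|\},q\in[n]\}$, and for coalitions $C,C'\ni i$, $C\succsim_i C'$ iff $|R\cap C|/|C|\succsim_i^F|R\cap C'|/|C'|$. Preferences are strict if these orders are linear; naturally single-peaked if for each agent $i$ and fractions $x,y,z$ with $x>y>z$ or $z>y>x$ (usual order of rationals), $x\succ_i^F y$ implies $y\succsim_i^F z$. The singleton partition is $\{\{i\}:i\in N\}$. An IS deviation of agent $i$ from partition $\pi$ to $\pi'$ is a move of $i$ alone from $\pi(i)$ into another coalition of $\pi$ or into a new singleton such that $\pi'(i)\succ_i\pi(i)$ and $\pi'(j)\succsim_j\pi(j)$ for all $j\in\pi'(i)\setminus\{i\}$. A coalition is homogeneous if it is contained in $R$ or in $B$. A deviation of $i$ satisfies solitary homogeneity if, whenever the new coalition $\pi'(i)$ is homogeneous, $\pi'(i)=\{i\}$. *)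

theory Defs
  imports Complex_Main "HOL-Library.Disjoint_Sets"
begin

text \<open>Agents are natural numbers; N is the (finite) agent set, R \<subseteq> N the red agents,
  B = N - R the blue agents. A preference profile assigns to each agent i a binary
  relation pref i on rationals, where pref i x y means x is weakly preferred to y
  (by i) as a fraction of red agents.\<close>

type_synonym profile = "nat \<Rightarrow> rat \<Rightarrow> rat \<Rightarrow> bool"

definition fractions :: "nat set \<Rightarrow> nat set \<Rightarrow> rat set" where
  "fractions N R = {of_nat p / of_nat q | p q. p \<le> card R \<and> 1 \<le> q \<and> q \<le> card N}"

definition weak_order_on :: "rat set \<Rightarrow> (rat \<Rightarrow> rat \<Rightarrow> bool) \<Rightarrow> bool" where
  "weak_order_on F P \<longleftrightarrow>
     (\<forall>x\<in>F. \<forall>y\<in>F. P x y \<or> P y x) \<and>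
     (\<forall>x\<in>F. \<forall>y\<in>F. \<forall>z\<in>F. P x y \<longrightarrow> P y z \<longrightarrow> P x z)"

definition hdg :: "nat set \<Rightarrow> nat set \<Rightarrow> profile \<Rightarrow> bool" where
  "hdg N R pref \<longleftrightarrow> finite N \<and> N \<noteq> {} \<and> R \<subseteq> N \<and>
     (\<forall>i\<in>N. weak_order_on (fractions N R) (pref i))"

definition strict_prefs :: "nat set \<Rightarrow> nat set \<Rightarrow> profile \<Rightarrow> bool" where
  "strict_prefs N R pref \<longleftrightarrow> (\<forall>i\<in>N. \<forall>x\<in>fractions N R. \<forall>y\<in>fractions N R.
      pref i x y \<longrightarrow> pref i y x \<longrightarrow> x = y)"

definition spref :: "(rat \<Rightarrow> rat \<Rightarrow> bool) \<Rightarrow> rat \<Rightarrow> rat \<Rightarrow> bool" where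
  "spref P x y \<longleftrightarrow> P x y \<and> \<not> P y x"

definition nat_single_peaked :: "nat set \<Rightarrow> nat set \<Rightarrow> profile \<Rightarrow> bool" where
  "nat_single_peaked N R pref \<longleftrightarrow> (\<forall>i\<in>N. \<forall>x\<in>fractions N R. \<forall>y\<in>fractions N R.
      \<forall>z\<in>fractions N R. ((x > y \<and> y > z) \<or> (z > y \<and> y > x)) \<longrightarrow>
        spref (pref i) x y \<longrightarrow> pref i y z)"

definition red_frac :: "nat set \<Rightarrow> nat set \<Rightarrow> rat" where
  "red_frac R C = of_nat (card (R \<inter> C)) / of_nat (card C)"

definition singleton_partition :: "nat set \<Rightarrow> nat set set" where
  "singleton_partition N = {{i} | i. i \<in> N}"

definition block :: "nat set set \<Rightarrow> nat \<Rightarrow> nat set" where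
  "block \<pi> i = (THE X. X \<in> \<pi> \<and> i \<in> X)"

text \<open>Agent i moves alone to coalition C (C \<in> \<pi> not containing i, or C = {} meaning a
  new singleton coalition); the resulting partition.\<close>
definition move :: "nat set set \<Rightarrow> nat \<Rightarrow> nat set \<Rightarrow> nat set set" where
  "move \<pi> i C = insert (insert i C) ({X - {i} | X. X \<in> \<pi> \<and> X \<noteq> C} - {{}})"

definition IS_deviation ::
  "nat set \<Rightarrow> nat set \<Rightarrow> profile \<Rightarrow> nat set set \<Rightarrow> nat \<Rightarrow> nat set \<Rightarrow> nat set set \<Rightarrow> bool" where
  "IS_deviation N R pref \<pi> i C \<pi>' \<longleftrightarrow>
     i \<in> N \<and> ((C \<in> \<pi> \<and> i \<notin> C) \<or> C = {}) \<and> \<pi>' = move \<pi> i C \<and>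
     spref (pref i) (red_frac R (insert i C)) (red_frac R (block \<pi> i)) \<and>
     (\<forall>j\<in>C. pref j (red_frac R (insert i C)) (red_frac R C))"

definition homogeneous :: "nat set \<Rightarrow> nat set \<Rightarrow> nat set \<Rightarrow> bool" where
  "homogeneous N R C \<longleftrightarrow> C \<subseteq> R \<or> C \<subseteq> N - R"

definition solitary_homogeneity :: "nat set \<Rightarrow> nat set \<Rightarrow> nat \<Rightarrow> nat set \<Rightarrow> bool" where
  "solitary_homogeneity N R i C \<longleftrightarrow> (homogeneous N R (insert i C) \<longrightarrow> insert i C = {i})"

datatype restriction = NatSinglePeaked | Strict | SingletonStart | SolitaryHomogeneity

end

theory Submission
  imports Defs
begin

text \<open>For each omitted restriction there is a small game, found by computer search, whose dynamics
  runs through finitely many partitions and returns to an earlier one. Single-peaked preferences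
  come from the utilities \<open>x \<mapsto> min (a * x) (c - d * x)\<close> in the red fraction \<open>x\<close>; ties are broken
  towards larger fractions to make preferences strict, and capping the utility at a constant
  yields indifferences where these are allowed. When deviations to homogeneous coalitions are
  allowed, a pair of red agents forms after \<open>{r\<^sub>1, r\<^sub>2, b}\<close> loses \<open>r\<^sub>1\<close> to a coalition
  with a larger red fraction and \<open>r\<^sub>2\<close> flees from \<open>{r\<^sub>2, b}\<close>; the cycle starts from there.\<close>

section \<open>Preferences induced by utilities\<close>

definition upref :: "(nat \<Rightarrow> rat \<Rightarrow> 'b::linorder) \<Rightarrow> profile" where
  "upref u i x y \<longleftrightarrow> u i y \<le> u i x"

definition lexpref :: "(nat \<Rightarrow> rat \<Rightarrow> 'b::linorder) \<Rightarrow> profile" where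
  "lexpref u i x y \<longleftrightarrow> u i y < u i x \<or> u i x = u i y \<and> y \<le> x"

definition tent :: "(rat \<times> rat \<times> rat) list \<Rightarrow> nat \<Rightarrow> rat \<Rightarrow> rat" where
  "tent ps i x = (case ps ! i of (a, c, d) \<Rightarrow> min (a * x) (c - d * x))"

lemma weak_order_on_upref: "weak_order_on F (upref u i)"
  unfolding weak_order_on_def upref_def by auto

lemma weak_order_on_lexpref: "weak_order_on F (lexpref u i)"
  unfolding weak_order_on_def lexpref_def by (auto intro: less_trans)

lemma strict_prefs_lexpref: "strict_prefs N R (lexpref u)"
  unfolding strict_prefs_def lexpref_def by auto

text \<open>Let \<open>x > y > z\<close>. If \<open>u i y\<close> were the falling part
  \<open>g y \<ge> g x\<close>, it could not lie below \<open>u i x\<close>; so it is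
  \<open>f y\<close>, which is at least \<open>f z\<close> and hence at least \<open>u i z\<close>.
  The other direction swaps \<open>f\<close> and \<open>g\<close>.\<close>

lemma nat_single_peaked_upref:
  assumes "\<And>i. i \<in> N \<Longrightarrow> \<exists>f g. mono f \<and> antimono g \<and> u i = (\<lambda>x. min (f x) (g x))"
  shows "nat_single_peaked N R (upref u)"
  unfolding nat_single_peaked_def
proof (intro ballI impI)
  fix i x y z
  assume "i \<in> N" and btw: "(x > y \<and> y > z) \<or> (z > y \<and> y > x)"
    and xy: "spref (upref u i) x y"
  then obtain f g where fg: "mono f" "antimono g" "u i = (\<lambda>x. min (f x) (g x))"
    using assms by blast
  have lt: "min (f y) (g y) < min (f x) (g x)"
  proof -
    have "u i y < u i x" using xy by (simp add: spref_def upref_def not_le)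
    then show ?thesis using fg(3) by simp
  qed
  have "min (f z) (g z) \<le> min (f y) (g y)"
    using btw
  proof
    assume "x > y \<and> y > z"
    then have "g x \<le> g y" "f z \<le> f y"
      using fg by (simp_all add: monoD antimonoD)
    then show ?thesis using lt by (auto simp: min_def split: if_splits)
  next
    assume "z > y \<and> y > x"
    then have "f x \<le> f y" "g z \<le> g y"
      using fg by (simp_all add: monoD antimonoD)
    then show ?thesis using lt by (auto simp: min_def split: if_splits)
  qed
  then show "upref u i y z" using fg(3) by (simp add: upref_def)
qed

text \<open>The tie-break could spoil single-peakedness on a plateau. Strict monotonicity excludes
  this: \<open>u i y \<le> u i x\<close> already forces \<open>u i z < u i y\<close>, so
  \<open>y\<close> beats \<open>z\<close> by utility alone.\<close>

lemma nat_single_peaked_lexpref: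
  assumes "\<And>i. i \<in> N \<Longrightarrow> \<exists>f g. strict_mono f \<and> strict_antimono_on UNIV g \<and>
    u i = (\<lambda>x. min (f x) (g x))"
  shows "nat_single_peaked N R (lexpref u)"
  unfolding nat_single_peaked_def
proof (intro ballI impI)
  fix i x y z
  assume "i \<in> N" and btw: "(x > y \<and> y > z) \<or> (z > y \<and> y > x)"
    and xy: "spref (lexpref u i) x y"
  then obtain f g where fg: "strict_mono f" "strict_antimono_on UNIV g"
      "u i = (\<lambda>x. min (f x) (g x))"
    using assms by blast
  have le: "min (f y) (g y) \<le> min (f x) (g x)"
  proof -
    have "u i y \<le> u i x" using xy by (auto simp: spref_def lexpref_def)
    then show ?thesis using fg(3) by simp
  qed
  have "min (f z) (g z) < min (f y) (g y)"
    using btw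
  proof
    assume "x > y \<and> y > z"
    then have "g x < g y" "f z < f y"
      using fg by (simp_all add: strict_monoD monotone_onD[OF fg(2)])
    then show ?thesis using le by (auto simp: min_def split: if_splits)
  next
    assume "z > y \<and> y > x"
    then have "f x < f y" "g z < g y"
      using fg by (simp_all add: strict_monoD monotone_onD[OF fg(2)])
    then show ?thesis using le by (auto simp: min_def split: if_splits)
  qed
  then show "lexpref u i y z" using fg(3) by (simp add: lexpref_def)
qed

lemma nat_single_peaked_lexpref_tent:
  assumes "length ps = n" "\<forall>(a, c, d) \<in> set ps. 0 < a \<and> 0 < d"
  shows "nat_single_peaked {..<n} R (lexpref (tent ps))"
proof (rule nat_single_peaked_lexpref)
  fix i assume "i \<in> {..<n}"
  obtain a c d where acd: "ps ! i = (a, c, d)" by (cases "ps ! i") auto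
  with \<open>i \<in> _\<close> have "(a, c, d) \<in> set ps" using assms(1) by (metis lessThan_iff nth_mem)
  with assms(2) have "0 < a" "0 < d" by auto
  then have "strict_mono ((*) a)" "strict_antimono_on UNIV (\<lambda>x. c - d * x)"
    by (auto simp: strict_mono_def intro!: monotone_onI)
  then show "\<exists>f g. strict_mono f \<and> strict_antimono_on UNIV g \<and> tent ps i = (\<lambda>x. min (f x) (g x))"
    using acd by (intro exI[of _ "(*) a"] exI[of _ "\<lambda>x. c - d * x"]) (auto simp: tent_def)
qed

text \<open>By associativity of \<open>min\<close> the cap is absorbed into the rising part, which
  stays monotone. Slopes may be zero here, as no strictness is claimed.\<close>

lemma nat_single_peaked_upref_capped_tent:
  assumes "length ps = n" "\<forall>(a, c, d) \<in> set ps. 0 \<le> a \<and> 0 \<le> d"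
  shows "nat_single_peaked {..<n} R (upref (\<lambda>i x. min e (tent ps i x)))"
proof (rule nat_single_peaked_upref)
  fix i assume "i \<in> {..<n}"
  obtain a c d where acd: "ps ! i = (a, c, d)" by (cases "ps ! i") auto
  with \<open>i \<in> _\<close> have "(a, c, d) \<in> set ps" using assms(1) by (metis lessThan_iff nth_mem)
  with assms(2) have "0 \<le> a" "0 \<le> d" by auto
  then have "mono (\<lambda>x. min e (a * x))" "antimono (\<lambda>x. c - d * x)"
    by (auto intro!: monoI antimonoI min.mono mult_left_mono)
  then show "\<exists>f g. mono f \<and> antimono g \<and> (\<lambda>x. min e (tent ps i x)) = (\<lambda>x. min (f x) (g x))"
    using acd by (intro exI[of _ "\<lambda>x. min e (a * x)"] exI[of _ "\<lambda>x. c - d * x"])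
      (auto simp: tent_def min.assoc)
qed

section \<open>Partitions as lists of labels\<close>

definition cell :: "nat list \<Rightarrow> nat \<Rightarrow> nat set" where
  "cell xs c = {j. j < length xs \<and> xs ! j = c}"

definition cells :: "nat list \<Rightarrow> nat set set" where
  "cells xs = {cell xs (xs ! i) | i. i < length xs}"

definition same_cells :: "nat list \<Rightarrow> nat list \<Rightarrow> bool" where
  "same_cells xs ys \<longleftrightarrow> length xs = length ys \<and>
     (\<forall>i\<in>set [0..<length xs]. \<forall>j\<in>set [0..<length xs]. xs ! i = xs ! j \<longleftrightarrow> ys ! i = ys ! j)"

definition share :: "nat \<Rightarrow> nat list \<Rightarrow> nat \<Rightarrow> rat" where
  "share k xs c = of_nat (count_list (take k xs) c) / of_nat (count_list xs c)"

lemma cells_cong: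
  assumes "same_cells xs ys"
  shows "cells xs = cells ys"
proof -
  have "length xs = length ys" using assms by (simp add: same_cells_def)
  moreover have "cell xs (xs ! i) = cell ys (ys ! i)" if "i < length xs" for i
    using assms that by (auto simp: same_cells_def cell_def)
  ultimately show ?thesis
    unfolding cells_def by metis
qed

lemma cells_upt: "cells [0..<n] = singleton_partition {..<n}"
  unfolding cells_def cell_def singleton_partition_def by auto

lemma partition_on_cells: "partition_on {..<length xs} (cells xs)"
  by (rule partition_onI) (auto simp: cells_def cell_def disjnt_def)

lemma block_cells:
  assumes "i < length xs"
  shows "block (cells xs) i = cell xs (xs ! i)"
  unfolding block_def
  by (rule the_equality) (use assms in \<open>auto simp: cells_def cell_def\<close>)

lemma card_cell: "card (cell xs c) = count_list xs c"
  by (simp add: cell_def count_list_eq_length_filter length_filter_conv_card eq_commute)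

lemma red_frac_cell:
  assumes "k \<le> length xs"
  shows "red_frac {..<k} (cell xs c) = share k xs c"
proof -
  have "{..<k} \<inter> cell xs c = cell (take k xs) c"
    using assms by (auto simp: cell_def)
  then show ?thesis by (simp add: red_frac_def share_def card_cell)
qed

lemma cell_update:
  assumes "i < length xs"
  shows "cell (xs[i := c]) b = (if b = c then insert i (cell xs c) else cell xs b - {i})"
  using assms by (auto simp: cell_def nth_list_update split: if_splits)

lemma move_cells:
  assumes "i < length xs" "xs ! i \<noteq> c"
  shows "move (cells xs) i (cell xs c) = cells (xs[i := c])"
proof -
  have cells_alt: "X \<in> cells ys \<longleftrightarrow> (\<exists>b. X = cell ys b) \<and> X \<noteq> {}" for X ys
  proof
    assume "X \<in> cells ys"
    then obtain j where j: "j < length ys" "X = cell ys (ys ! j)" by (auto simp: cells_def)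
    then have "j \<in> X" by (simp add: cell_def)
    with j show "(\<exists>b. X = cell ys b) \<and> X \<noteq> {}" by blast
  next
    assume "(\<exists>b. X = cell ys b) \<and> X \<noteq> {}"
    then obtain b j where b: "X = cell ys b" "j \<in> X" by blast
    then have "j < length ys" "b = ys ! j" by (auto simp: cell_def)
    with b(1) show "X \<in> cells ys" unfolding cells_def by blast
  qed
  \<comment> \<open>\<open>move\<close> excludes the target as a set, while updating distinguishes
    labels; on nonempty cells the two agree.\<close>
  have neq: "cell xs b \<noteq> cell xs c" if "b \<noteq> c" "cell xs b \<noteq> {}" for b
  proof -
    from that(2) obtain j where j: "j \<in> cell xs b" by blast
    with that(1) have "j \<notin> cell xs c" by (simp add: cell_def)
    with j show ?thesis by blast
  qed
  have mem_move: "X \<in> move (cells xs) i (cell xs c) \<longleftrightarrow> X = insert i (cell xs c) \<or>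
    (\<exists>b. X = cell xs b - {i} \<and> cell xs b \<noteq> cell xs c \<and> X \<noteq> {})" for X
    unfolding move_def insert_iff Diff_iff mem_Collect_eq cells_alt by blast
  show ?thesis
  proof (intro equalityI subsetI)
    fix X assume "X \<in> move (cells xs) i (cell xs c)"
    then consider "X = insert i (cell xs c)"
      | b where "X = cell xs b - {i}" "cell xs b \<noteq> cell xs c" "X \<noteq> {}"
      unfolding mem_move by blast
    then show "X \<in> cells (xs[i := c])"
    proof cases
      case 1
      then have "X = cell (xs[i := c]) c" using assms by (simp add: cell_update)
      then show ?thesis using 1 cells_alt by blast
    next
      case (2 b)
      then have "b \<noteq> c" by blast
      then have "X = cell (xs[i := c]) b" using 2 assms by (simp add: cell_update)
      then show ?thesis using 2 cells_alt by blast
    qed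
  next
    fix X assume "X \<in> cells (xs[i := c])"
    then obtain b where b: "X = cell (xs[i := c]) b" "X \<noteq> {}"
      using cells_alt by blast
    show "X \<in> move (cells xs) i (cell xs c)"
    proof (cases "b = c")
      case True
      then show ?thesis using b assms by (simp add: mem_move cell_update)
    next
      case False
      then have X: "X = cell xs b - {i}" using b assms by (simp add: cell_update)
      with b(2) have "cell xs b \<noteq> {}" by blast
      with False have "cell xs b \<noteq> cell xs c" by (rule neq)
      then show ?thesis unfolding mem_move using X b(2) by blast
    qed
  qed
qed

section \<open>Deviations checked on label lists\<close>

definition legal :: "nat \<Rightarrow> profile \<Rightarrow> nat list \<Rightarrow> nat \<Rightarrow> nat \<Rightarrow> bool" where
  "legal k P xs i c \<longleftrightarrow> i < length xs \<and> xs ! i \<noteq> c \<and>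
     (let s = share k (xs[i := c]) c; t = share k xs c in
       spref (P i) s (share k xs (xs ! i)) \<and>
       (\<forall>j\<in>set [0..<length xs]. xs ! j = c \<longrightarrow> P j s t))"

lemma IS_deviation_cells:
  assumes "legal k P xs i c" "k \<le> length xs"
  shows "IS_deviation {..<length xs} {..<k} P (cells xs) i (cell xs c) (cells (xs[i := c]))"
proof -
  from assms(1) have i: "i < length xs" "xs ! i \<noteq> c"
    by (simp_all add: legal_def)
  have ins: "insert i (cell xs c) = cell (xs[i := c]) c"
    using i by (simp add: cell_update)
  show ?thesis
    unfolding IS_deviation_def
  proof (intro conjI)
    show "cell xs c \<in> cells xs \<and> i \<notin> cell xs c \<or> cell xs c = {}"
      using i by (auto simp: cells_def cell_def)
    show "\<forall>j\<in>cell xs c. P j (red_frac {..<k} (insert i (cell xs c))) (red_frac {..<k} (cell xs c))"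
      using assms unfolding ins
      by (simp add: red_frac_cell) (auto simp: legal_def Let_def cell_def)
  qed (use assms i in \<open>auto simp: ins block_cells red_frac_cell move_cells legal_def Let_def\<close>)
qed

lemma red_frac_homogeneous:
  assumes "homogeneous N R C"
  shows "red_frac R C \<in> {0, 1}"
proof -
  from assms consider "R \<inter> C = C" | "R \<inter> C = {}"
    unfolding homogeneous_def by blast
  then show ?thesis by cases (simp_all add: red_frac_def)
qed

lemma solitary_homogeneity_cells:
  assumes "k \<le> length xs" "i < length xs"
    and "share k (xs[i := c]) c \<in> {0, 1} \<longrightarrow> c \<notin> set xs"
  shows "solitary_homogeneity {..<length xs} {..<k} i (cell xs c)"
  unfolding solitary_homogeneity_def
proof
  assume "homogeneous {..<length xs} {..<k} (insert i (cell xs c))"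
  then have "red_frac {..<k} (insert i (cell xs c)) \<in> {0, 1}"
    by (rule red_frac_homogeneous)
  moreover have "insert i (cell xs c) = cell (xs[i := c]) c"
    using assms(2) by (simp add: cell_update)
  ultimately have "share k (xs[i := c]) c \<in> {0, 1}"
    using assms(1) by (simp only: red_frac_cell length_list_update)
  with assms(3) have "c \<notin> set xs" by blast
  then have "cell xs c = {}" by (auto simp: cell_def)
  then show "insert i (cell xs c) = {i}" by simp
qed

section \<open>From finite tables to infinite runs\<close>

text \<open>Each row of a table consists of a state and of the agent and the target label of the deviation
  performed there; the agents below \<open>k\<close> are red. Successors are looked up modulo renaming of labels.\<close>

definition closed_table ::
    "nat \<Rightarrow> nat \<Rightarrow> profile \<Rightarrow> bool \<Rightarrow> (nat list \<times> nat \<times> nat) list \<Rightarrow> bool" where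
  "closed_table n k P sol T \<longleftrightarrow> k \<le> n \<and> list_all (\<lambda>(xs, i, c).
     length xs = n \<and> legal k P xs i c \<and>
     (sol \<longrightarrow> share k (xs[i := c]) c \<in> {0, 1} \<longrightarrow> c \<notin> set xs) \<and>
     list_ex (\<lambda>(ys, _). same_cells (xs[i := c]) ys) T) T"

text \<open>Each state in the table has a deviation whose result is, as a partition, again a state
  of the table, so dependent choice never gets stuck.\<close>

lemma infinite_run:
  assumes T: "closed_table n k P sol T" and start: "start \<in> fst ` set T"
  obtains \<pi> where "\<pi> 0 = cells start" "partition_on {..<n} (\<pi> 0)"
    "\<And>m::nat. \<exists>i C. IS_deviation {..<n} {..<k} P (\<pi> m) i C (\<pi> (Suc m)) \<and>
       (sol \<longrightarrow> solitary_homogeneity {..<n} {..<k} i C)"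
proof -
  define step where "step xs ys \<longleftrightarrow>
    (\<exists>i C. IS_deviation {..<n} {..<k} P (cells xs) i C (cells ys) \<and>
       (sol \<longrightarrow> solitary_homogeneity {..<n} {..<k} i C))" for xs ys
  have ex: "\<exists>ys. ys \<in> fst ` set T \<and> step xs ys" if "xs \<in> fst ` set T" for xs
  proof -
    from that obtain i c where row: "(xs, i, c) \<in> set T" by auto
    have k: "k \<le> n" using T by (simp add: closed_table_def)
    from T row have *: "length xs = n" "legal k P xs i c"
        "sol \<longrightarrow> share k (xs[i := c]) c \<in> {0, 1} \<longrightarrow> c \<notin> set xs"
      and "list_ex (\<lambda>(ys, _). same_cells (xs[i := c]) ys) T"
      by (auto simp: closed_table_def list_all_iff)
    then obtain ys where ys: "ys \<in> fst ` set T" "cells (xs[i := c]) = cells ys"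
      by (force simp: list_ex_iff dest: cells_cong)
    have "i < length xs" using * by (simp add: legal_def)
    have "IS_deviation {..<n} {..<k} P (cells xs) i (cell xs c) (cells ys)"
      using IS_deviation_cells[OF *(2)] *(1) k ys(2) by simp
    moreover have "sol \<longrightarrow> solitary_homogeneity {..<n} {..<k} i (cell xs c)"
      using solitary_homogeneity_cells[of k xs i c] \<open>i < length xs\<close> * k by blast
    ultimately have "step xs ys"
      unfolding step_def by blast
    with ys(1) show ?thesis by blast
  qed
  obtain st where st: "st 0 = start" "\<And>m::nat. st m \<in> fst ` set T \<and> step (st m) (st (Suc m))"
  proof -
    \<comment> \<open>The clause for \<open>m = 0\<close> pins the first state, which
      \<open>dependent_nat_choice\<close> leaves open.\<close>
    have "\<exists>f. \<forall>m::nat. (f m \<in> fst ` set T \<and> (m = 0 \<longrightarrow> f m = start)) \<and> step (f m) (f (Suc m))"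
      by (rule dependent_nat_choice) (use start ex in auto)
    then show thesis using that by blast
  qed
  have "length start = n"
    using T start by (auto simp: closed_table_def list_all_iff)
  show thesis
  proof (rule that)
    show "cells (st 0) = cells start" by (simp add: st(1))
    show "partition_on {..<n} (cells (st 0))"
      using partition_on_cells[of start] \<open>length start = n\<close> by (simp add: st(1))
    show "\<exists>i C. IS_deviation {..<n} {..<k} P (cells (st m)) i C (cells (st (Suc m))) \<and>
        (sol \<longrightarrow> solitary_homogeneity {..<n} {..<k} i C)" for m
      using st(2) unfolding step_def by blast
  qed
qed

text \<open>Restrictions outside \<open>S\<close> become vacuous implications, so one lemma serves
  all four cases.\<close>

lemma closed_table_witness:
  assumes T: "closed_table n k P sol T" and start: "start \<in> fst ` set T" and "0 < n"
    and weak: "\<And>F i. weak_order_on F (P i)"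
    and sp: "NatSinglePeaked \<in> S \<longrightarrow> nat_single_peaked {..<n} {..<k} P"
    and strict: "Strict \<in> S \<longrightarrow> strict_prefs {..<n} {..<k} P"
    and single: "SingletonStart \<in> S \<longrightarrow> start = [0..<n]"
    and sol: "SolitaryHomogeneity \<in> S \<longrightarrow> sol"
  shows "\<exists>N R pref \<pi>.
           hdg N R pref \<and>
           (NatSinglePeaked \<in> S \<longrightarrow> nat_single_peaked N R pref) \<and>
           (Strict \<in> S \<longrightarrow> strict_prefs N R pref) \<and>
           partition_on N (\<pi> 0) \<and>
           (SingletonStart \<in> S \<longrightarrow> \<pi> 0 = singleton_partition N) \<and>
           (\<forall>k::nat. \<exists>i C. IS_deviation N R pref (\<pi> k) i C (\<pi> (Suc k)) \<and>
                (SolitaryHomogeneity \<in> S \<longrightarrow> solitary_homogeneity N R i C))"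
proof -
  obtain \<pi> where \<pi>: "\<pi> 0 = cells start" "partition_on {..<n} (\<pi> 0)"
    "\<And>m. \<exists>i C. IS_deviation {..<n} {..<k} P (\<pi> m) i C (\<pi> (Suc m)) \<and>
       (sol \<longrightarrow> solitary_homogeneity {..<n} {..<k} i C)"
    using infinite_run[OF T start] by blast
  have "k \<le> n" using T by (simp add: closed_table_def)
  then have "hdg {..<n} {..<k} P"
    using weak \<open>0 < n\<close> by (simp add: hdg_def lessThan_empty_iff)
  moreover have "SingletonStart \<in> S \<longrightarrow> \<pi> 0 = singleton_partition {..<n}"
    using single \<pi>(1) cells_upt by simp
  moreover have "\<forall>m. \<exists>i C. IS_deviation {..<n} {..<k} P (\<pi> m) i C (\<pi> (Suc m)) \<and>
       (SolitaryHomogeneity \<in> S \<longrightarrow> solitary_homogeneity {..<n} {..<k} i C)"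
    using \<pi>(3) sol by meson
  ultimately show ?thesis
    using sp strict \<pi>(2) by blast
qed

section \<open>The four cycles\<close>

text \<open>Reds rank 2/3, then 1/3, then 1/2, then the rest; blues rank blue fractions likewise. As
  1/2 is worse than both neighbours, a mixed pair welcomes a third agent of either colour. Blues
  leave 2/3 trios for 1/3 trios and reds do the reverse; the monochromatic pairs left behind split
  up to form new mixed pairs.\<close>

definition prefs_not_single_peaked :: profile where
  "prefs_not_single_peaked = lexpref (\<lambda>i x. let y = (if i < 3 then x else 1 - x) in
     if y = 2/3 then 3 else if y = 1/3 then 2 else if y = 1/2 then 1 else (0::nat))"

definition cycle_not_single_peaked :: "(nat list \<times> nat \<times> nat) list" where
  "cycle_not_single_peaked =
    [([0, 1, 2, 3, 4, 5], 4, 2),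
     ([0, 1, 2, 3, 2, 4], 5, 0),
     ([0, 1, 2, 3, 2, 0], 3, 1),
     ([0, 1, 2, 1, 2, 0], 1, 2),
     ([0, 1, 1, 2, 1, 0], 4, 0),
     ([0, 1, 1, 2, 0, 0], 1, 2),
     ([0, 1, 2, 1, 0, 0], 0, 1),
     ([0, 0, 1, 0, 2, 2], 5, 1),
     ([0, 0, 1, 0, 2, 1], 3, 1),
     ([0, 0, 1, 1, 2, 1], 1, 2),
     ([0, 1, 2, 2, 1, 2], 2, 1),
     ([0, 1, 1, 2, 1, 2], 5, 0)]"

lemma closed_not_single_peaked:
  "closed_table 6 3 prefs_not_single_peaked True cycle_not_single_peaked"
  by code_simp

text \<open>Agent 0 is indifferent up to 1/2, agents 1 and 2 want few reds, 4 and 5 many. Agents 3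
  and 6 are flat on [1/4, 2/5], so they accept first a blue and then a red newcomer; at 1/2 only 6
  prefers to be alone.\<close>

definition params_with_ties :: "(rat \<times> rat \<times> rat) list" where
  "params_with_ties =
    [(0, 1, 2), (0, 0, 1), (0, 0, 1), (4, 3, 5), (1, 1, 0), (1, 1, 0), (4, 9, 20)]"

lemma nat_single_peaked_with_ties:
  "nat_single_peaked {..<7} R (upref (\<lambda>i x. min 1 (tent params_with_ties i x)))"
  by (rule nat_single_peaked_upref_capped_tent) (simp_all add: params_with_ties_def)

text \<open>After two moves a cycle begins, whose second half repeats the first with 1, 5 and 2, 4
  exchanged.\<close>

definition cycle_with_ties :: "(nat list \<times> nat \<times> nat) list" where
  "cycle_with_ties =
    [([0, 1, 2, 3, 4, 5, 6], 5, 1),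
     ([0, 1, 2, 3, 4, 1, 5], 3, 0),
     ([0, 1, 2, 0, 3, 1, 4], 6, 0),
     ([0, 1, 2, 0, 3, 1, 0], 4, 0),
     ([0, 1, 2, 0, 0, 1, 0], 1, 0),
     ([0, 0, 1, 0, 0, 2, 0], 4, 1),
     ([0, 0, 1, 0, 1, 2, 0], 6, 3),
     ([0, 0, 1, 0, 1, 2, 3], 3, 4),
     ([0, 0, 1, 2, 1, 3, 4], 0, 2),
     ([0, 1, 2, 0, 2, 3, 4], 6, 0),
     ([0, 1, 2, 0, 2, 3, 0], 5, 0),
     ([0, 1, 2, 0, 2, 0, 0], 2, 0),
     ([0, 1, 0, 0, 2, 0, 0], 5, 1),
     ([0, 1, 0, 0, 2, 1, 0], 6, 3),
     ([0, 1, 0, 0, 2, 1, 3], 3, 4),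
     ([0, 1, 0, 2, 3, 1, 4], 0, 2)]"

lemma closed_with_ties:
  "closed_table 7 3 (upref (\<lambda>i x. min 1 (tent params_with_ties i x))) True cycle_with_ties"
  by code_simp

text \<open>Two ties are resolved upwards: agent 0 has utility 5 at 1/4 and at 1, hence leaves for a
  singleton; agent 7 has utility 0 at 0 and at 1/2, hence joins it.\<close>

definition params_arbitrary_start :: "(rat \<times> rat \<times> rat) list" where
  "params_arbitrary_start =
    [(20, 8, 3), (1, 1, 1), (1, 1, 1), (1, 1, 1), (1, 1, 2), (1, 1, 1), (1, 1, 2), (1, 1, 2)]"

lemma nat_single_peaked_arbitrary_start:
  "nat_single_peaked {..<8} R (lexpref (tent params_arbitrary_start))"
  by (rule nat_single_peaked_lexpref_tent) (simp_all add: params_arbitrary_start_def)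

text \<open>The blue agents 2, 3, 5 start together and never move. The two halves of the cycle
  exchange 4 and 6.\<close>

definition cycle_arbitrary_start :: "(nat list \<times> nat \<times> nat) list" where
  "cycle_arbitrary_start =
    [([0, 1, 2, 2, 3, 2, 0, 0], 1, 2),
     ([0, 1, 1, 1, 2, 1, 0, 0], 0, 1),
     ([0, 0, 0, 0, 1, 0, 2, 2], 1, 1),
     ([0, 1, 0, 0, 1, 0, 2, 2], 0, 3),
     ([0, 1, 2, 2, 1, 2, 3, 3], 7, 0),
     ([0, 1, 2, 2, 1, 2, 3, 0], 4, 0),
     ([0, 1, 2, 2, 0, 2, 3, 0], 1, 2),
     ([0, 1, 1, 1, 0, 1, 2, 0], 0, 1),
     ([0, 0, 0, 0, 1, 0, 2, 1], 1, 2),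
     ([0, 1, 0, 0, 2, 0, 1, 2], 0, 3),
     ([0, 1, 2, 2, 3, 2, 1, 3], 7, 0),
     ([0, 1, 2, 2, 3, 2, 1, 0], 6, 0)]"

lemma closed_arbitrary_start:
  "closed_table 8 2 (lexpref (tent params_arbitrary_start)) True cycle_arbitrary_start"
  by code_simp

text \<open>Agent 1 has utility 1 at both 1/2 and 1; the tie-break makes it flee a mixed pair to
  join a lone red agent.\<close>

definition params_homogeneous_moves :: "(rat \<times> rat \<times> rat) list" where
  "params_homogeneous_moves =
    [(1, 1, 1), (2, 2, 1), (1, 1, 1), (1, 3, 3), (1, 3, 3), (1, 3, 3),
     (1, 2, 1), (1, 2, 1), (1, 2, 1)]"

lemma nat_single_peaked_homogeneous_moves:
  "nat_single_peaked {..<9} R (lexpref (tent params_homogeneous_moves))"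
  by (rule nat_single_peaked_lexpref_tent) (simp_all add: params_homogeneous_moves_def)

text \<open>The coalition {3, 4, 5, 8} serves to draw 3 away from {1, 3, 6}, and is fixed from then
  on. The last six rows form the cycle, in which 1 alternates between red partners 0 and 2.\<close>

definition cycle_homogeneous_moves :: "(nat list \<times> nat \<times> nat) list" where
  "cycle_homogeneous_moves =
    [([0, 1, 2, 3, 4, 5, 6, 7, 8], 6, 3),
     ([0, 1, 2, 3, 4, 5, 3, 6, 7], 1, 3),
     ([0, 1, 2, 1, 3, 4, 1, 5, 6], 8, 3),
     ([0, 1, 2, 1, 3, 4, 1, 5, 3], 5, 3),
     ([0, 1, 2, 1, 3, 3, 1, 4, 3], 3, 3),
     ([0, 1, 2, 3, 3, 3, 1, 4, 3], 1, 0),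
     ([0, 0, 1, 2, 2, 2, 3, 4, 2], 7, 1),
     ([0, 0, 1, 2, 2, 2, 3, 1, 2], 7, 0),
     ([0, 0, 1, 2, 2, 2, 3, 0, 2], 0, 3),
     ([0, 1, 2, 3, 3, 3, 0, 1, 3], 1, 2),
     ([0, 1, 1, 2, 2, 2, 0, 3, 2], 6, 1),
     ([0, 1, 1, 2, 2, 2, 1, 3, 2], 2, 3),
     ([0, 1, 2, 3, 3, 3, 1, 2, 3], 1, 0)]"

lemma closed_homogeneous_moves:
  "closed_table 9 6 (lexpref (tent params_homogeneous_moves)) False cycle_homogeneous_moves"
  by code_simp

theorem theorem4p2:
  fixes S :: "restriction set"
  assumes "card S = 3"
  shows "\<exists>N R pref \<pi>.
           hdg N R pref \<and>
           (NatSinglePeaked \<in> S \<longrightarrow> nat_single_peaked N R pref) \<and>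
           (Strict \<in> S \<longrightarrow> strict_prefs N R pref) \<and>
           partition_on N (\<pi> 0) \<and>
           (SingletonStart \<in> S \<longrightarrow> \<pi> 0 = singleton_partition N) \<and>
           (\<forall>k::nat. \<exists>i C. IS_deviation N R pref (\<pi> k) i C (\<pi> (Suc k)) \<and>
                (SolitaryHomogeneity \<in> S \<longrightarrow> solitary_homogeneity N R i C))"
proof -
  have "NatSinglePeaked \<notin> S \<or> Strict \<notin> S \<or> SingletonStart \<notin> S \<or> SolitaryHomogeneity \<notin> S"
  proof (rule ccontr)
    assume "\<not> ?thesis"
    then have "{NatSinglePeaked, Strict, SingletonStart, SolitaryHomogeneity} \<subseteq> S" by blast
    moreover have "finite S" using assms by (simp add: card_ge_0_finite)
    ultimately have "card {NatSinglePeaked, Strict, SingletonStart, SolitaryHomogeneity} \<le> card S"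
      by (rule card_mono[rotated])
    then show False using assms by simp
  qed
  then show ?thesis
  proof (elim disjE)
    assume 1: "NatSinglePeaked \<notin> S"
    have "[0..<6] \<in> fst ` set cycle_not_single_peaked"
      by code_simp
    then show ?thesis
      by (rule closed_table_witness[OF closed_not_single_peaked])
        (use 1 in \<open>simp_all add: prefs_not_single_peaked_def weak_order_on_lexpref strict_prefs_lexpref\<close>)
  next
    assume 2: "Strict \<notin> S"
    have "[0..<7] \<in> fst ` set cycle_with_ties"
      by code_simp
    then show ?thesis
      by (rule closed_table_witness[OF closed_with_ties])
        (use 2 in \<open>simp_all add: weak_order_on_upref nat_single_peaked_with_ties\<close>)
  next
    assume 3: "SingletonStart \<notin> S"
    have "fst (hd cycle_arbitrary_start) \<in> fst ` set cycle_arbitrary_start"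
      by code_simp
    then show ?thesis
      by (rule closed_table_witness[OF closed_arbitrary_start])
        (use 3 in \<open>simp_all add: weak_order_on_lexpref strict_prefs_lexpref nat_single_peaked_arbitrary_start\<close>)
  next
    assume 4: "SolitaryHomogeneity \<notin> S"
    have "[0..<9] \<in> fst ` set cycle_homogeneous_moves"
      by code_simp
    then show ?thesis
      by (rule closed_table_witness[OF closed_homogeneous_moves])
        (use 4 in \<open>simp_all add: weak_order_on_lexpref strict_prefs_lexpref nat_single_peaked_homogeneous_moves\<close>)
  qed
qed

end
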